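(* Let $X$ be the limit of the Lang–Plaut inverse system of graphs (with $m=4$) described in the context, fix an arbitrary constant $A>1$, and let $\tilde{\mathcal{B}}$ be the collection of all balls $B(v,A4^{-k})$ in $X$ with $k\in\mathbb{N}$ and $v\in X$ a vertex of level $k$. There is no constant $C>0$ such that $$\sum_{B\in\tilde{\mathcal{B}}}\beta_\Gamma(B)\,\operatorname{diam}(B)\le C\,\mathcal{H}^1(\Gamma)$$ for all rectifiable curves $\Gamma\subset X$.
   Context: **The inverse system.** Let $G$ be the graph with six vertices $s,a,b,b',c,t$ and six edges $sa,\ ab,\ ab',\ bc,\ b'c,\ ct$. Let $X_0$ be the graph with two vertices and one edge of length $1$, identified with $[0,1]$. For $i\ge1$, $X_i$ is formed by replacing each edge of $X_{i-1}$ with a copy of $G$ in which each edge has length $4^{-i}$ (the endpoints of the replaced edge becoming $s$ and $t$, with $s$ the endpoint of smaller $\pi_0$-value), with the shortest path metric $d_i$. The map $\pi_{i-1}:X_i\to X_{i-1}$ collapses each copy of $G$ onto the edge of $X_{i-1}$ it replaced: it sends $s,a,\{b,b'\},c,t$ to the successive points of the subdivision of that edge into four equal parts, and is an isometry on each edge. **Limit.** $X=\{(v_i)\in\prod_{i\ge0}X_i:\pi_i(v_{i+1})=v_i\text{ for all }i\ge0\}$ with metric $d((v_i),(w_i))=\lim_{i\to\infty}d_i(v_i,w_i)$. The projection $X\to X_0\cong[0,1]$, $(v_j)\mapsto v_0$, is denoted $\pi_0$. A point $x\in X$ is a vertex of level $k$ if $\pi_0(x)\in4^{-k}\mathbb{Z}$.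 $B(x,r)=\{y\in X:d(x,y)<r\}$. **Monotone geodesics and $\beta$-numbers.** A monotone geodesic in $X$ is a geodesic arc $L\subset X$ such that $\pi_0|_L$ is an isometry onto $X_0\cong[0,1]$. For a set $E\subset X$ and a metric ball $B\subset X$, $$\beta_E(B)=\frac{1}{\operatorname{diam}(B)}\inf_L\sup_{x\in E\cap B}\operatorname{dist}(x,L),$$ where the infimum is over all monotone geodesics $L$ in $X$ (the supremum over the empty set is $0$). $\mathcal{H}^1$ is one-dimensional Hausdorff measure. *)

theory Defs
  imports "HOL-Analysis.Analysis"
begin

section \<open>The inverse system of graphs\<close>

datatype gvertex = Gs | Ga | Gb | Gb' | Gc | Gt
datatype gedge = Gsa | Gab | Gab' | Gbc | Gb'c | Gct

primrec gsrc :: "gedge \<Rightarrow> gvertex" where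
  "gsrc Gsa = Gs" | "gsrc Gab = Ga" | "gsrc Gab' = Ga"
| "gsrc Gbc = Gb" | "gsrc Gb'c = Gb'" | "gsrc Gct = Gc"

primrec gtgt :: "gedge \<Rightarrow> gvertex" where
  "gtgt Gsa = Ga" | "gtgt Gab = Gb" | "gtgt Gab' = Gb'"
| "gtgt Gbc = Gc" | "gtgt Gb'c = Gc" | "gtgt Gct = Gt"

text \<open>The position, in units of a quarter edge, to which the collapsing map sends a vertex of $G$.\<close>

primrec gpos :: "gvertex \<Rightarrow> real" where
  "gpos Gs = 0" | "gpos Ga = 1" | "gpos Gb = 2" | "gpos Gb' = 2" | "gpos Gc = 3" | "gpos Gt = 4"

text \<open>An edge of $X_i$ is a word of length $i$ over the edges of $G$: \<open>e # w\<close> is the edge \<open>e\<close> of the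
  copy of $G$ replacing the edge \<open>w\<close> of $X_{i-1}$, and \<open>[]\<close> is the edge of $X_0$.
  The vertices are the two vertices of $X_0$ together with the interior vertices
  \<open>New w g\<close> (\<open>g\<close> different from \<open>Gs\<close>, \<open>Gt\<close>) of the copies of $G$. A vertex keeps its name in all
  later graphs.\<close>

type_synonym lp_edge = "gedge list"

datatype lp_vertex = End0 | End1 | New lp_edge gvertex

text \<open>\<open>glue w g\<close> is the vertex \<open>g\<close> of the copy of $G$ replacing \<open>w\<close>; its \<open>Gs\<close> and \<open>Gt\<close> are the
  endpoints of \<open>w\<close>. Every edge is oriented in the direction of increasing $\pi_0$.\<close>

primrec glue :: "lp_edge \<Rightarrow> gvertex \<Rightarrow> lp_vertex" where
  "glue [] g = (case g of Gs \<Rightarrow> End0 | Gt \<Rightarrow> End1 | _ \<Rightarrow> New [] g)"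
| "glue (e # w) g =
     (case g of Gs \<Rightarrow> glue w (gsrc e) | Gt \<Rightarrow> glue w (gtgt e) | _ \<Rightarrow> New (e # w) g)"

definition src :: "lp_edge \<Rightarrow> lp_vertex" where "src w = glue w Gs"
definition tgt :: "lp_edge \<Rightarrow> lp_vertex" where "tgt w = glue w Gt"

text \<open>A point of a graph $X_i$ is a vertex, or the interior point \<open>Mid w t\<close> dividing the
  edge \<open>w\<close> in the ratio $t : 1-t$ for some $0 < t < 1$. \<open>along w\<close> parametrizes the closed edge.\<close>

datatype lp_point = Vert lp_vertex | Mid lp_edge real

definition along :: "lp_edge \<Rightarrow> real \<Rightarrow> lp_point" where
  "along w t = (if t = 0 then Vert (src w) else if t = 1 then Vert (tgt w) else Mid w t)"

definition X_graph :: "nat \<Rightarrow> lp_point set" where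
  "X_graph i = {along w t | w t. length w = i \<and> t \<in> {0..1}}"

text \<open>\<open>lp_path i x y L\<close>: some path of length \<open>L\<close> joins \<open>x\<close> to \<open>y\<close> in $X_i$ and consists of finitely
  many segments, each running inside one closed edge. Edges of $X_i$ have length $4^{-i}$.\<close>

inductive lp_path :: "nat \<Rightarrow> lp_point \<Rightarrow> lp_point \<Rightarrow> real \<Rightarrow> bool" for i x where
  start: "x \<in> X_graph i \<Longrightarrow> lp_path i x x 0"
| step: "lp_path i x (along w s) L \<Longrightarrow> length w = i \<Longrightarrow> s \<in> {0..1} \<Longrightarrow> t \<in> {0..1} \<Longrightarrow>
    lp_path i x (along w t) (L + \<bar>s - t\<bar> / 4 ^ i)"

definition graph_dist :: "nat \<Rightarrow> lp_point \<Rightarrow> lp_point \<Rightarrow> real" where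
  "graph_dist i x y = Inf {L. lp_path i x y L}"

text \<open>The collapsing map from $X_{i+1}$ to $X_i$. It fixes the vertices that already belong
  to $X_i$; the new ones are the \<open>New w g\<close> with \<open>length w = i\<close>. See \<open>collapse_along\<close> below.\<close>

fun collapse :: "nat \<Rightarrow> lp_point \<Rightarrow> lp_point" where
  "collapse i (Vert (New w g)) =
     (if length w = i then along w (gpos g / 4) else Vert (New w g))"
| "collapse i (Vert v) = Vert v"
| "collapse i (Mid w t) = along (tl w) ((gpos (gsrc (hd w)) + t) / 4)"

lemma glue_New: "glue w g = New u h \<Longrightarrow> length u \<le> length w \<and> (length u = length w \<longrightarrow> u = w \<and> h = g)"
  by (induction w arbitrary: g) (fastforce split: gvertex.splits)+

lemma glue_inner: "g \<noteq> Gs \<Longrightarrow> g \<noteq> Gt \<Longrightarrow> glue w g = New w g"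
  by (cases w; cases g) auto

lemma src_Cons: "src (e # w) = glue w (gsrc e)" and tgt_Cons: "tgt (e # w) = glue w (gtgt e)"
  by (auto simp: src_def tgt_def)

lemma endpoint_New: "src w = New u h \<or> tgt w = New u h \<Longrightarrow> length u < length w"
proof (induction w)
  case Nil
  then show ?case by (auto simp: src_def tgt_def)
next
  case (Cons e w)
  then obtain g where "glue w g = New u h" by (auto simp: src_Cons tgt_Cons)
  then show ?case by (auto dest: glue_New)
qed

lemma collapse_glue: "length w = i \<Longrightarrow> collapse i (Vert (glue w g)) = along w (gpos g / 4)"
proof -
  assume w: "length w = i"
  show ?thesis
  proof (cases "g = Gs \<or> g = Gt")
    case True
    then have v: "Vert (glue w g) = along w (gpos g / 4)"
      by (auto simp: along_def src_def tgt_def)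
    have "length u \<noteq> i" if "glue w g = New u h" for u h
      using endpoint_New[of w u h] that True w by (auto simp: src_def tgt_def)
    then have "collapse i (Vert (glue w g)) = Vert (glue w g)"
      by (cases "glue w g") auto
    with v show ?thesis by simp
  qed (use w glue_inner in auto)
qed

lemma gpos_gtgt: "gpos (gtgt e) = gpos (gsrc e) + 1"
  by (cases e) auto

lemma gpos_gsrc: "gpos (gsrc e) \<in> {0..3}"
  by (cases e) auto

lemma collapse_along:
  assumes "length w = i"
  shows "collapse i (along (e # w) t) = along w ((gpos (gsrc e) + t) / 4)"
proof -
  consider "t = 0" | "t = 1" | "t \<noteq> 0" "t \<noteq> 1" by blast
  then show ?thesis
  proof cases
    case 1
    then have "along (e # w) t = Vert (glue w (gsrc e))" by (simp add: along_def src_Cons)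
    then show ?thesis using 1 collapse_glue[OF assms] by simp
  next
    case 2
    then have "along (e # w) t = Vert (glue w (gtgt e))" by (simp add: along_def tgt_Cons)
    then show ?thesis using 2 collapse_glue[OF assms] gpos_gtgt by simp
  next
    case 3
    then have "along (e # w) t = Mid (e # w) t" by (simp add: along_def)
    then show ?thesis by simp
  qed
qed

lemma collapse_X_graph: "x \<in> X_graph (Suc i) \<Longrightarrow> collapse i x \<in> X_graph i"
proof -
  assume "x \<in> X_graph (Suc i)"
  then obtain e w t where x: "x = along (e # w) t" "length w = i" "t \<in> {0..1}"
    by (auto simp: X_graph_def length_Suc_conv)
  then show ?thesis
    using gpos_gsrc[of e] unfolding x(1) collapse_along[OF x(2)] X_graph_def
    by (intro CollectI exI[of _ w] exI[of _ "(gpos (gsrc e) + t) / 4"]) auto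
qed

section \<open>The path metrics\<close>

lemma lp_path_in: "lp_path i x y L \<Longrightarrow> x \<in> X_graph i \<and> y \<in> X_graph i \<and> 0 \<le> L"
proof (induction rule: lp_path.induct)
  case (step w s L t)
  have "along w t \<in> X_graph i" using step.hyps unfolding X_graph_def by blast
  then show ?case using step.IH by simp
qed simp

lemma lp_path_trans: "lp_path i y z L' \<Longrightarrow> lp_path i x y L \<Longrightarrow> lp_path i x z (L + L')"
proof (induction rule: lp_path.induct)
  case start
  then show ?case by simp
next
  case (step w s L' t)
  then show ?case using lp_path.step[of i x w s "L + L'" t] by (simp add: add.assoc)
qed

lemma lp_path_edge:
  "length w = i \<Longrightarrow> s \<in> {0..1} \<Longrightarrow> t \<in> {0..1} \<Longrightarrow> lp_path i (along w s) (along w t) (\<bar>s - t\<bar> / 4 ^ i)"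
  using lp_path.step[of i "along w s" w s 0 t] lp_path.start[of "along w s" i]
  by (auto simp: X_graph_def)

lemma lp_path_sym: "lp_path i x y L \<Longrightarrow> lp_path i y x L"
proof (induction rule: lp_path.induct)
  case start
  then show ?case by (rule lp_path.start)
next
  case (step w s L t)
  then show ?case
    using lp_path_trans[OF _ lp_path_edge[of w i t s]] by (metis abs_minus_commute add.commute)
qed

lemma lp_path_lipschitz:
  assumes "\<And>w s t. length w = i \<Longrightarrow> s \<in> {0..1} \<Longrightarrow> t \<in> {0..1} \<Longrightarrow>
    \<bar>f (along w s) - f (along w t)\<bar> \<le> \<bar>s - t\<bar>"
  shows "lp_path i x y L \<Longrightarrow> \<bar>f x - f y\<bar> / 4 ^ i \<le> L"
proof (induction rule: lp_path.induct)
  case start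
  then show ?case by simp
next
  case (step w s L t)
  have "\<bar>f x - f (along w t)\<bar> \<le> \<bar>f x - f (along w s)\<bar> + \<bar>s - t\<bar>"
    using assms[OF step(2-4)] by linarith
  then have "\<bar>f x - f (along w t)\<bar> / 4 ^ i \<le> (\<bar>f x - f (along w s)\<bar> + \<bar>s - t\<bar>) / 4 ^ i"
    by (intro divide_right_mono) auto
  then show ?case using step.IH by (simp add: add_divide_distrib)
qed

lemma lp_path_collapse: "lp_path (Suc i) x y L \<Longrightarrow> lp_path i (collapse i x) (collapse i y) L"
proof (induction rule: lp_path.induct)
  case start
  then show ?case by (auto intro: lp_path.start collapse_X_graph)
next
  case (step w s L t)
  then obtain e u where w: "w = e # u" "length u = i" by (auto simp: length_Suc_conv)
  let ?a = "\<lambda>r. (gpos (gsrc e) + r) / 4"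
  have *: "\<bar>?a s - ?a t\<bar> / 4 ^ i = \<bar>s - t\<bar> / 4 ^ Suc i"
  proof -
    have "?a s - ?a t = (s - t) / 4" by (simp add: field_simps)
    then have "\<bar>?a s - ?a t\<bar> = \<bar>s - t\<bar> / 4" by (simp only: abs_divide abs_numeral)
    then show ?thesis by (simp only: divide_divide_eq_left power_Suc)
  qed
  have "lp_path i (collapse i x) (along u (?a t)) (L + \<bar>?a s - ?a t\<bar> / 4 ^ i)"
    using step gpos_gsrc[of e] w by (intro lp_path.step) (auto simp: collapse_along)
  then show ?case unfolding * using w by (simp add: collapse_along)
qed

lemma lp_path_across:
  "length w \<le> N \<Longrightarrow> lp_path N (Vert (src w)) (Vert (tgt w)) (1 / 4 ^ length w)"
proof (induction "N - length w" arbitrary: w)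
  case 0
  then show ?case using lp_path_edge[of w N 0 1] by (simp add: along_def)
next
  case (Suc k)
  define l where "l = (1::real) / 4 ^ Suc (length w)"
  have *: "lp_path N (Vert (glue w (gsrc e))) (Vert (glue w (gtgt e))) l" for e
    using Suc.hyps(1)[of "e # w"] Suc.hyps(2) by (simp add: src_Cons tgt_Cons l_def)
  have "lp_path N (Vert (glue w Gs)) (Vert (glue w Gt)) (((l + l) + l) + l)"
    by (rule lp_path_trans[OF *[of Gct, simplified]] lp_path_trans[OF *[of Gbc, simplified]]
        lp_path_trans[OF *[of Gab, simplified]] *[of Gsa, simplified])+
  moreover have "((l + l) + l) + l = 1 / 4 ^ length w" by (simp add: l_def)
  ultimately show ?case by (simp add: src_def tgt_def)
qed

lemma lp_path_ascend:
  assumes "length w < N"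
  shows "lp_path N (Vert (src w)) (Vert (glue w (gsrc e))) (gpos (gsrc e) / 4 ^ Suc (length w))"
proof -
  define l where "l = (1::real) / 4 ^ Suc (length w)"
  have *: "lp_path N (Vert (glue w (gsrc e))) (Vert (glue w (gtgt e))) l" for e
    using lp_path_across[of "e # w" N] assms by (simp add: src_Cons tgt_Cons l_def)
  have 0: "lp_path N (Vert (glue w Gs)) (Vert (glue w Gs)) 0"
    using lp_path_in[OF *[of Gsa]] by (auto intro: lp_path.start)
  have a: "lp_path N (Vert (glue w Gs)) (Vert (glue w Ga)) l" using *[of Gsa] by simp
  have b: "lp_path N (Vert (glue w Gs)) (Vert (glue w Gb)) (l + l)"
    by (rule lp_path_trans[OF *[of Gab, simplified] a])
  have b': "lp_path N (Vert (glue w Gs)) (Vert (glue w Gb')) (l + l)"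
    by (rule lp_path_trans[OF *[of Gab', simplified] a])
  have c: "lp_path N (Vert (glue w Gs)) (Vert (glue w Gc)) (l + l + l)"
    by (rule lp_path_trans[OF *[of Gbc, simplified] b])
  have *: "gpos g / 4 ^ Suc (length w) = gpos g * l" for g by (simp add: l_def)
  have "2 * l = l + l" "3 * l = l + l + l" by simp_all
  then show ?thesis unfolding * src_def using 0 a b b' c by (cases e) simp_all
qed

lemma lp_path_from_End0:
  "length w \<le> N \<Longrightarrow> \<exists>L \<le> 1 - 1 / 4 ^ length w. lp_path N (Vert End0) (Vert (src w)) L"
proof (induction w)
  case Nil
  have "lp_path N (Vert (src [])) (Vert (src [])) 0"
    using lp_path_in[OF lp_path_across[of "[]" N]] by (auto intro: lp_path.start)
  then show ?case by (auto simp: src_def)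
next
  case (Cons e w)
  then obtain L where L: "L \<le> 1 - 1 / 4 ^ length w" "lp_path N (Vert End0) (Vert (src w)) L"
    by auto
  let ?l = "gpos (gsrc e) / 4 ^ Suc (length w)"
  have "lp_path N (Vert End0) (Vert (src (e # w))) (L + ?l)"
    using lp_path_trans[OF lp_path_ascend[of w N e] L(2)] Cons.prems by (simp add: src_Cons)
  moreover have "?l \<le> 3 / 4 ^ Suc (length w)"
    using gpos_gsrc[of e] by (intro divide_right_mono) auto
  then have "L + ?l \<le> 1 - 1 / 4 ^ length (e # w)"
    using L(1) by simp
  ultimately show ?case by blast
qed

lemma lp_path_exists:
  assumes "x \<in> X_graph i" "y \<in> X_graph i"
  shows "\<exists>L \<le> 2. lp_path i x y L"
proof -
  have *: "\<exists>L \<le> 1. lp_path i (Vert End0) z L" if "z \<in> X_graph i" for z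
  proof -
    obtain w t where z: "z = along w t" "length w = i" "t \<in> {0..1}"
      using \<open>z \<in> X_graph i\<close> by (auto simp: X_graph_def)
    obtain L where L: "L \<le> 1 - 1 / 4 ^ i" "lp_path i (Vert End0) (Vert (src w)) L"
      using lp_path_from_End0[of w i] z by auto
    have "lp_path i (Vert End0) z (L + \<bar>0 - t\<bar> / 4 ^ i)"
      using lp_path_trans[OF lp_path_edge[of w i 0 t] ] L z by (simp add: along_def)
    moreover have "\<bar>0 - t\<bar> / 4 ^ i \<le> 1 / 4 ^ i"
      using z by (intro divide_right_mono) auto
    ultimately show ?thesis using L(1) by (intro exI[of _ "L + \<bar>0 - t\<bar> / 4 ^ i"]) auto
  qed
  obtain L L' where "L \<le> 1" "lp_path i (Vert End0) x L" "L' \<le> 1" "lp_path i (Vert End0) y L'"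
    using * assms by blast
  then show ?thesis
    using lp_path_trans[OF _ lp_path_sym] by (intro exI[of _ "L + L'"]) auto
qed

lemma lp_path_bdd: "bdd_below {L. lp_path i x y L}"
  using lp_path_in by (intro bdd_belowI[of _ 0]) blast

lemma graph_dist_le: "lp_path i x y L \<Longrightarrow> graph_dist i x y \<le> L"
  unfolding graph_dist_def by (auto intro: cInf_lower lp_path_bdd)

lemma graph_dist_geI:
  assumes "x \<in> X_graph i" "y \<in> X_graph i" "\<And>L. lp_path i x y L \<Longrightarrow> c \<le> L"
  shows "c \<le> graph_dist i x y"
  unfolding graph_dist_def using lp_path_exists[OF assms(1,2)] assms(3)
  by (intro cInf_greatest) auto

lemma graph_dist_nonneg: "x \<in> X_graph i \<Longrightarrow> y \<in> X_graph i \<Longrightarrow> 0 \<le> graph_dist i x y"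
  using lp_path_in by (blast intro: graph_dist_geI)

lemma graph_dist_le_2: "x \<in> X_graph i \<Longrightarrow> y \<in> X_graph i \<Longrightarrow> graph_dist i x y \<le> 2"
  using lp_path_exists[of x i y] graph_dist_le by fastforce

lemma graph_dist_refl: "x \<in> X_graph i \<Longrightarrow> graph_dist i x x = 0"
  by (intro antisym graph_dist_le graph_dist_nonneg lp_path.start)

lemma graph_dist_sym: "graph_dist i x y = graph_dist i y x"
proof -
  have "lp_path i x y = lp_path i y x" using lp_path_sym by blast
  then show ?thesis by (simp add: graph_dist_def)
qed

lemma graph_dist_triangle:
  assumes "x \<in> X_graph i" "y \<in> X_graph i" "z \<in> X_graph i"
  shows "graph_dist i x z \<le> graph_dist i x y + graph_dist i y z"
proof -
  have "graph_dist i x z - L \<le> graph_dist i y z" if "lp_path i x y L" for L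
    using assms lp_path_trans[OF _ that] graph_dist_le by (intro graph_dist_geI) fastforce+
  then have "graph_dist i x z - graph_dist i y z \<le> graph_dist i x y"
    using assms by (intro graph_dist_geI) fastforce+
  then show ?thesis by simp
qed

lemma graph_dist_collapse:
  assumes "x \<in> X_graph (Suc i)" "y \<in> X_graph (Suc i)"
  shows "graph_dist i (collapse i x) (collapse i y) \<le> graph_dist (Suc i) x y"
  using assms by (intro graph_dist_geI graph_dist_le lp_path_collapse)

lemma graph_dist_eq_0:
  assumes x: "x \<in> X_graph i" and y: "y \<in> X_graph i" and 0: "graph_dist i x y = 0"
  shows "x = y"
proof -
  have "\<exists>f::lp_point \<Rightarrow> real. f x = 0 \<and> (f y = 0 \<longrightarrow> x = y) \<and>
    (\<forall>w s t. s \<in> {0..1} \<longrightarrow> t \<in> {0..1} \<longrightarrow> \<bar>f (along w s) - f (along w t)\<bar> \<le> \<bar>s - t\<bar>)"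
  proof (cases x)
    case (Mid w t)
    then have t: "0 < t" "t < 1" using x by (auto simp: X_graph_def along_def split: if_splits)
    define m where "m = min t (1 - t)"
    define f where "f = (\<lambda>p. case p of Mid w' s \<Rightarrow> if w' = w then min \<bar>s - t\<bar> m else m | _ \<Rightarrow> m)"
    have f: "f (along w' s) = (if w' = w then min \<bar>s - t\<bar> m else m)" if "s \<in> {0..1}" for w' s
      using that t by (auto simp: f_def along_def m_def)
    have "\<bar>f (along w s) - f (along w t)\<bar> \<le> \<bar>s - t\<bar>" if "s \<in> {0..1}" "t \<in> {0..1}" for w s t
      unfolding f[OF that(1)] f[OF that(2)] by (auto simp: min_def)
    moreover have "m > 0" using t by (auto simp: m_def)
    moreover from this have "f x = 0" "f y = 0 \<longrightarrow> x = y"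
      by (auto simp: f_def Mid min_def split: lp_point.splits if_splits)
    ultimately show ?thesis by blast
  next
    case (Vert v)
    define F where "F = (\<lambda>w s::real. min (if src w = v then s else 1/2) (if tgt w = v then 1 - s else 1/2))"
    define f where "f = (\<lambda>p. case p of Mid w s \<Rightarrow> F w s | Vert u \<Rightarrow> if u = v then 0 else 1/2)"
    have f: "f (along w s) = F w s" if "s \<in> {0..1}" for w s
      using that by (auto simp: f_def F_def along_def)
    have "\<bar>f (along w s) - f (along w t)\<bar> \<le> \<bar>s - t\<bar>" if "s \<in> {0..1}" "t \<in> {0..1}" for w s t
      unfolding f[OF that(1)] f[OF that(2)] using that by (auto simp: F_def min_def)
    moreover have "f y = 0 \<longrightarrow> x = y"
    proof (cases y)
      case (Mid w s)
      then have "0 < s" "s < 1" using y by (auto simp: X_graph_def along_def split: if_splits)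
      then have "F w s > 0" by (auto simp: F_def)
      then show ?thesis by (simp add: f_def Mid)
    qed (auto simp: f_def Vert)
    moreover have "f x = 0" by (simp add: f_def Vert)
    ultimately show ?thesis by blast
  qed
  then obtain f :: "lp_point \<Rightarrow> real" where f: "f x = 0" "f y = 0 \<longrightarrow> x = y"
    "\<And>w s t. s \<in> {0..1} \<Longrightarrow> t \<in> {0..1} \<Longrightarrow> \<bar>f (along w s) - f (along w t)\<bar> \<le> \<bar>s - t\<bar>"
    by blast
  have "\<bar>f x - f y\<bar> / 4 ^ i \<le> graph_dist i x y"
    using x y f(3) by (intro graph_dist_geI lp_path_lipschitz) auto
  then have "f y = 0" using 0 f(1) by (simp add: field_simps)
  then show ?thesis using f(2) by simp
qed

section \<open>The limit space\<close>

typedef lp_limit = "{v :: nat \<Rightarrow> lp_point. (\<forall>i. v i \<in> X_graph i) \<and> (\<forall>i. collapse i (v (Suc i)) = v i)}"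
  morphisms coords Abs_lp_limit
proof -
  have "Vert End0 \<in> X_graph i" for i
  proof -
    have "src (replicate i Gsa) = End0" by (induction i) (auto simp: src_def)
    then show ?thesis
      by (force simp: X_graph_def along_def intro: exI[of _ "replicate i Gsa"] exI[of _ 0])
  qed
  then show ?thesis by (intro exI[of _ "\<lambda>_. Vert End0"]) auto
qed

lemma coords_X: "coords x i \<in> X_graph i"
  and coords_collapse: "collapse i (coords x (Suc i)) = coords x i"
  using coords[of x] by auto

lemma graph_dist_coords_incseq: "incseq (\<lambda>i. graph_dist i (coords x i) (coords y i))"
  using graph_dist_collapse[OF coords_X coords_X] by (intro incseq_SucI) (simp add: coords_collapse)

lemma graph_dist_coords_convergent: "convergent (\<lambda>i. graph_dist i (coords x i) (coords y i))"
proof -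
  have "\<forall>i. graph_dist i (coords x i) (coords y i) \<le> 2"
    by (simp add: graph_dist_le_2 coords_X)
  then show ?thesis
    using incseq_convergent[OF graph_dist_coords_incseq] unfolding convergent_def by blast
qed

instantiation lp_limit :: metric_space
begin

definition dist_lp_limit :: "lp_limit \<Rightarrow> lp_limit \<Rightarrow> real" where
  "dist x y = lim (\<lambda>i. graph_dist i (coords x i) (coords y i))"

definition uniformity_lp_limit :: "(lp_limit \<times> lp_limit) filter" where
  "(uniformity :: (lp_limit \<times> lp_limit) filter) = (INF e\<in>{0 <..}. principal {(x, y). dist x y < e})"

definition open_lp_limit :: "lp_limit set \<Rightarrow> bool" where
  "open (U :: lp_limit set) \<longleftrightarrow> (\<forall>x\<in>U. eventually (\<lambda>(x', y). x' = x \<longrightarrow> y \<in> U) uniformity)"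

instance
proof
  have conv: "(\<lambda>i. graph_dist i (coords x i) (coords y i)) \<longlonglongrightarrow> dist x y" for x y
    unfolding dist_lp_limit_def using graph_dist_coords_convergent convergent_LIMSEQ_iff by blast
  fix x y z :: lp_limit
  have le: "graph_dist i (coords x i) (coords y i) \<le> dist x y" for i
    using graph_dist_coords_incseq conv by (rule incseq_le)
  show "dist x y = 0 \<longleftrightarrow> x = y"
  proof
    assume "dist x y = 0"
    then have "graph_dist i (coords x i) (coords y i) = 0" for i
      using le[of i] graph_dist_nonneg[OF coords_X[of x i] coords_X[of y i]] by linarith
    then have "coords x i = coords y i" for i
      using graph_dist_eq_0 coords_X by blast
    then show "x = y" by (simp add: coords_inject[symmetric] fun_eq_iff)
  qed (simp add: dist_lp_limit_def graph_dist_refl coords_X)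
  have "graph_dist i (coords x i) (coords y i)
      \<le> graph_dist i (coords x i) (coords z i) + graph_dist i (coords y i) (coords z i)" for i
    using graph_dist_triangle[OF coords_X coords_X coords_X] graph_dist_sym by metis
  then show "dist x y \<le> dist x z + dist y z"
    by (intro LIMSEQ_le[OF conv tendsto_add[OF conv conv]]) blast
qed (rule uniformity_lp_limit_def open_lp_limit_def)+

end

text \<open>The identification of $X_0$ with $[0,1]$ is the inverse of \<open>along []\<close>.\<close>

definition pi0 :: "lp_limit \<Rightarrow> real" where
  "pi0 x = inv_into {0..1} (along []) (coords x 0)"

lemma inj_on_along_Nil: "inj_on (along []) {0..1}"
  by (auto simp: inj_on_def along_def src_def tgt_def split: if_splits)

lemma pi0_in: "pi0 x \<in> {0..1}" and coords_0: "coords x 0 = along [] (pi0 x)"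
proof -
  have "coords x 0 \<in> along [] ` {0..1}" using coords_X[of x 0] by (auto simp: X_graph_def)
  then show "pi0 x \<in> {0..1}" "coords x 0 = along [] (pi0 x)"
    unfolding pi0_def by (rule inv_into_into, simp add: f_inv_into_f)
qed

definition vertex_of_level :: "nat \<Rightarrow> lp_limit \<Rightarrow> bool" where
  "vertex_of_level k x \<longleftrightarrow> (\<exists>z::int. pi0 x = of_int z / 4 ^ k)"

definition vertex_balls :: "real \<Rightarrow> lp_limit set set" where
  "vertex_balls A = {ball v (A / 4 ^ k) | v k. vertex_of_level k v}"

section \<open>Monotone geodesics and beta numbers\<close>

definition geodesic_arc :: "'a::metric_space set \<Rightarrow> bool" where
  "geodesic_arc L \<longleftrightarrow> (\<exists>(a::real) b \<gamma>. a < b \<and> L = \<gamma> ` {a..b} \<and>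
     (\<forall>s\<in>{a..b}. \<forall>t\<in>{a..b}. dist (\<gamma> s) (\<gamma> t) = \<bar>s - t\<bar>))"

definition monotone_geodesic :: "lp_limit set \<Rightarrow> bool" where
  "monotone_geodesic L \<longleftrightarrow> geodesic_arc L \<and>
     (\<forall>x\<in>L. \<forall>y\<in>L. \<bar>pi0 x - pi0 y\<bar> = dist x y) \<and> pi0 ` L = {0..1}"

definition beta :: "lp_limit set \<Rightarrow> lp_limit set \<Rightarrow> real" where
  "beta E B = 1 / diameter B *
     (INF L\<in>{L. monotone_geodesic L}.
        if E \<inter> B = {} then 0 else SUP x\<in>E \<inter> B. infdist x L)"

section \<open>Rectifiable curves and Hausdorff measure\<close>

definition rectifiable_path :: "(real \<Rightarrow> 'a::metric_space) \<Rightarrow> bool" where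
  "rectifiable_path \<gamma> \<longleftrightarrow> path \<gamma> \<and>
     (\<exists>K. \<forall>n (t :: nat \<Rightarrow> real). mono t \<and> range t \<subseteq> {0..1} \<longrightarrow>
        (\<Sum>i<n. dist (\<gamma> (t i)) (\<gamma> (t (Suc i)))) \<le> K)"

definition rectifiable_curve :: "'a::metric_space set \<Rightarrow> bool" where
  "rectifiable_curve \<Gamma> \<longleftrightarrow> (\<exists>\<gamma>. rectifiable_path \<gamma> \<and> \<Gamma> = path_image \<gamma>)"

text \<open>Boundedness is required because \<^const>\<open>diameter\<close> is a real number, meaningless for unbounded sets.\<close>

definition hausdorff1_delta :: "real \<Rightarrow> 'a::metric_space set \<Rightarrow> ennreal" where
  "hausdorff1_delta \<delta> E =
     (INF U\<in>{U :: nat \<Rightarrow> 'a set. E \<subseteq> (\<Union>i. U i) \<and> (\<forall>i. bounded (U i) \<and> diameter (U i) \<le> \<delta>)}.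
        \<Sum>i. ennreal (diameter (U i)))"

definition hausdorff1 :: "'a::metric_space set \<Rightarrow> ennreal" where
  "hausdorff1 E = (SUP \<delta>\<in>{0<..}. hausdorff1_delta \<delta> E)"

end

(* Travelling through the branch b of every copy of G gives a monotone geodesic M. Switching to the
   branch b' at a single level j gives a monotone geodesic that agrees with M at the vertices of
   level j but is at distance comparable to 4^-j from M halfway between them. A monotone geodesic
   cannot pass close to two points with the same pi_0-value, so it misses a curve running through
   both branches by an amount comparable to their distance.

   Attach to M detours into the other branch in 4^m generations, where generation k consists of 4^k
   detours of length 4^(-k-m), based at the points with pi_0-value (u + 1/4) / 4^k. Their total
   length is 1, but the balls of radius A 4^(-k-g) around the base point of a detour of generation
   k see it for all g <= m, so each detour contributes about m times its length to the sum. The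
   balls with 4^g >= 4A are distinct because their pi_0-images are distinct open intervals. *)

theory Submission
  imports Defs
begin

section \<open>Sections of the projection to the unit interval\<close>

text \<open>The two directed paths from \<open>Gs\<close> to \<open>Gt\<close> in G, listed by
  quarter. It is applied only to \<open>d < 4\<close>.\<close>

definition lane :: "bool \<Rightarrow> nat \<Rightarrow> gedge" where
  "lane b d = (if d = 0 then Gsa else if d = 1 then (if b then Gab' else Gab)
     else if d = 2 then (if b then Gb'c else Gbc) else Gct)"

lemma gpos_gsrc_lane: "d < 4 \<Longrightarrow> gpos (gsrc (lane b d)) = real d"
  by (auto simp: lane_def)

lemma gtgt_lane: "d < 3 \<Longrightarrow> gtgt (lane b d) = gsrc (lane b (Suc d))"
  by (auto simp: lane_def)

text \<open>\<open>word f i n\<close> is the edge of $X_i$ over the $n$-th interval of length $4^{-i}$ that takes the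
  branch $b'$ at level $l + 1$ exactly if \<open>f l\<close> holds.\<close>

primrec word :: "(nat \<Rightarrow> bool) \<Rightarrow> nat \<Rightarrow> nat \<Rightarrow> lp_edge" where
  "word f 0 n = []"
| "word f (Suc i) n = lane (f i) (n mod 4) # word f i (n div 4)"

lemma length_word [simp]: "length (word f i n) = i"
  by (induction i arbitrary: n) auto

text \<open>Consecutive edges meet either inside one copy of G, where both use the same branch
  because the flag depends on the level alone, or, for n = 3 mod 4, at the common endpoint of two
  consecutive parent edges, which is the induction hypothesis.\<close>

lemma tgt_word: "Suc n < 4 ^ i \<Longrightarrow> tgt (word f i n) = src (word f i (Suc n))"
proof (induction i arbitrary: n)
  case (Suc i)
  show ?case
  proof (cases "n mod 4 = 3")
    case True
    then have d: "Suc n mod 4 = 0" "Suc n div 4 = Suc (n div 4)" by presburger+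
    then have "Suc (n div 4) < 4 ^ i" using Suc.prems by (simp add: less_mult_imp_div_less mult.commute flip: d(2))
    then show ?thesis using Suc.IH[of "n div 4"] True d
      by (simp add: lane_def tgt_Cons src_Cons src_def tgt_def)
  next
    case False
    then have d: "Suc n mod 4 = Suc (n mod 4)" "Suc n div 4 = n div 4" "n mod 4 < 3" by presburger+
    then show ?thesis by (simp add: tgt_Cons src_Cons gtgt_lane)
  qed
qed auto

text \<open>Two different closed unit intervals with integer endpoints share a point only if they
  are consecutive, and then \<open>tgt_word\<close> identifies the two ends. This makes the
  parametrization over [0,1] well defined.\<close>

lemma along_word_unique:
  assumes "n < 4 ^ i" "real n \<le> x" "x \<le> real n + 1"
    and "n' < 4 ^ i" "real n' \<le> x" "x \<le> real n' + 1"
  shows "along (word f i n) (x - real n) = along (word f i n') (x - real n')"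
proof -
  have *: "along (word f i n) (x - real n) = along (word f i n') (x - real n')"
    if "n < n'" "n' < 4 ^ i" "x \<le> real n + 1" "real n' \<le> x" for n n'
  proof -
    have n': "n' = Suc n" and x: "x = real n + 1" using that by linarith+
    show ?thesis using that(2) tgt_word[of n i f] unfolding n' x by (simp add: along_def)
  qed
  show ?thesis
  proof (cases n n' rule: linorder_cases)
    case less
    then show ?thesis using assms by (intro *)
  next
    case greater
    then show ?thesis using assms by (intro *[symmetric])
  qed simp
qed

text \<open>The cap only matters at p = 1, where the floor 4^i would be one past the last
  edge.\<close>

definition geo_index :: "nat \<Rightarrow> real \<Rightarrow> nat" where
  "geo_index i p = min (nat \<lfloor>4 ^ i * p\<rfloor>) (4 ^ i - 1)"

lemma geo_index:
  assumes "p \<in> {0..1}"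
  shows "geo_index i p < 4 ^ i" "real (geo_index i p) \<le> 4 ^ i * p"
    "4 ^ i * p \<le> real (geo_index i p) + 1"
proof -
  have "(4::nat) ^ i > 0" by simp
  then show "geo_index i p < 4 ^ i" unfolding geo_index_def by linarith
  have "0 \<le> 4 ^ i * p" using assms by simp
  then have "real (nat \<lfloor>4 ^ i * p\<rfloor>) \<le> 4 ^ i * p" "4 ^ i * p \<le> real (nat \<lfloor>4 ^ i * p\<rfloor>) + 1"
    by linarith+
  moreover have "4 ^ i * p \<le> real (4 ^ i - 1) + 1" using assms by (simp add: of_nat_diff)
  ultimately show "real (geo_index i p) \<le> 4 ^ i * p" "4 ^ i * p \<le> real (geo_index i p) + 1"
    unfolding geo_index_def of_nat_min by linarith+
qed

definition geo_coord :: "(nat \<Rightarrow> bool) \<Rightarrow> nat \<Rightarrow> real \<Rightarrow> lp_point" where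
  "geo_coord f i p = along (word f i (geo_index i p)) (4 ^ i * p - real (geo_index i p))"

text \<open>Frees later arguments from the floor: at a point shared by two intervals, either may be
  used.\<close>

lemma geo_coord_eq:
  assumes "n < 4 ^ i" "real n \<le> 4 ^ i * p" "4 ^ i * p \<le> real n + 1"
  shows "geo_coord f i p = along (word f i n) (4 ^ i * p - real n)"
proof -
  have "real n + 1 \<le> 4 ^ i" using assms(1) by (metis Suc_leI of_nat_Suc of_nat_le_iff of_nat_numeral of_nat_power add.commute)
  then have "4 ^ i * p \<le> 4 ^ i * 1" using assms(3) by linarith
  then have "p \<le> 1" by (rule mult_left_le_imp_le) simp
  moreover have "0 \<le> 4 ^ i * p" using assms(2) by linarith
  then have "4 ^ i * 0 \<le> 4 ^ i * p" by simp
  then have "0 \<le> p" by (rule mult_left_le_imp_le) simp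
  ultimately have p: "p \<in> {0..1}" by simp
  show ?thesis unfolding geo_coord_def using geo_index[OF p] assms by (intro along_word_unique) auto
qed

lemma geo_coord_X:
  assumes "p \<in> {0..1}"
  shows "geo_coord f i p \<in> X_graph i"
proof -
  have "4 ^ i * p - real (geo_index i p) \<in> {0..1}" using geo_index(2,3)[OF assms, of i] by simp
  then show ?thesis unfolding geo_coord_def X_graph_def using length_word by blast
qed

text \<open>The edge numbered n lies in the copy of G over its parent n div 4, as quarter n mod 4.
  Both branches have the same position there, so the collapsed point does not see the flag of the
  new level.\<close>

lemma collapse_geo_coord:
  assumes p: "p \<in> {0..1}"
  shows "collapse i (geo_coord f (Suc i) p) = geo_coord f i p"
proof -
  define n where "n = geo_index (Suc i) p"
  have n: "n < 4 ^ Suc i" "real n \<le> 4 ^ Suc i * p" "4 ^ Suc i * p \<le> real n + 1"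
    using geo_index[OF p, of "Suc i"] by (auto simp: n_def)
  have nd: "real n = 4 * real (n div 4) + real (n mod 4)" "n mod 4 < 4"
    by (metis mult_div_mod_eq of_nat_add of_nat_mult of_nat_numeral) simp
  have "real (n mod 4) \<le> 3" using nd(2) by linarith
  then have "real (n div 4) \<le> 4 ^ i * p" "4 ^ i * p \<le> real (n div 4) + 1"
    using n(2,3) nd by auto
  moreover have "n div 4 < 4 ^ i" using n(1) by (simp add: less_mult_imp_div_less mult.commute)
  ultimately have "geo_coord f i p = along (word f i (n div 4)) (4 ^ i * p - real (n div 4))"
    by (intro geo_coord_eq)
  moreover have "(real (n mod 4) + (4 ^ Suc i * p - real n)) / 4 = 4 ^ i * p - real (n div 4)"
    using nd(1) by (simp add: field_simps)
  moreover have "collapse i (geo_coord f (Suc i) p) =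
      along (word f i (n div 4)) ((real (n mod 4) + (4 ^ Suc i * p - real n)) / 4)"
    by (simp add: geo_coord_def n_def[symmetric] collapse_along gpos_gsrc_lane)
  ultimately show ?thesis by (simp only:)
qed

text \<open>Meaningful for p in [0,1], where the coordinates form a point of the inverse limit; see
  \<open>coords_geo\<close>.\<close>

definition geo :: "(nat \<Rightarrow> bool) \<Rightarrow> real \<Rightarrow> lp_limit" where
  "geo f p = Abs_lp_limit (\<lambda>i. geo_coord f i p)"

lemma coords_geo: "p \<in> {0..1} \<Longrightarrow> coords (geo f p) i = geo_coord f i p"
  unfolding geo_def by (subst Abs_lp_limit_inverse) (auto simp: geo_coord_X collapse_geo_coord)

section \<open>Sections are monotone geodesics\<close>

lemma lp_path_geo_coord_edge:
  assumes "n < 4 ^ i" "real n \<le> 4 ^ i * p" "p \<le> q" "4 ^ i * q \<le> real n + 1"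
  shows "lp_path i (geo_coord f i p) (geo_coord f i q) (q - p)"
proof -
  have m: "4 ^ i * p \<le> 4 ^ i * q" using assms(3) by simp
  then have e: "geo_coord f i p = along (word f i n) (4 ^ i * p - real n)"
    "geo_coord f i q = along (word f i n) (4 ^ i * q - real n)"
    using assms by (intro geo_coord_eq; linarith)+
  have "\<bar>(4 ^ i * p - real n) - (4 ^ i * q - real n)\<bar> / 4 ^ i = q - p"
    using assms(3) by (simp add: abs_if m not_less flip: right_diff_distrib) (simp add: field_simps)
  then show ?thesis using lp_path_edge[of "word f i n" i "4 ^ i * p - real n" "4 ^ i * q - real n"] assms m
    unfolding e by simp
qed

lemma lp_path_geo_coord:
  assumes "n + d < 4 ^ i" "real n \<le> 4 ^ i * p" "4 ^ i * p \<le> real n + 1" "p \<le> q"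
    "real (n + d) \<le> 4 ^ i * q" "4 ^ i * q \<le> real (n + d) + 1"
  shows "lp_path i (geo_coord f i p) (geo_coord f i q) (q - p)"
  using assms
proof (induction d arbitrary: q)
  case 0
  then show ?case by (intro lp_path_geo_coord_edge[of n]) auto
next
  case (Suc d)
  \<comment> \<open>The left endpoint of the last interval: the induction covers the way up to
    \<open>r\<close>, and one edge remains.\<close>
  define r where "r = real (n + Suc d) / 4 ^ i"
  have r: "4 ^ i * r = real (n + d) + 1" by (simp add: r_def)
  have "4 ^ i * p \<le> 4 ^ i * r" "4 ^ i * r \<le> 4 ^ i * q" using Suc.prems r by auto
  then have pq: "p \<le> r" "r \<le> q" by (simp_all add: mult_le_cancel_left_pos)
  have "lp_path i (geo_coord f i p) (geo_coord f i r) (r - p)"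
    using Suc.prems r pq by (intro Suc.IH) auto
  moreover have "lp_path i (geo_coord f i r) (geo_coord f i q) (q - r)"
    using Suc.prems r pq by (intro lp_path_geo_coord_edge[of "n + Suc d"]) auto
  ultimately show ?case using lp_path_trans by fastforce
qed

lemma graph_dist_geo_coord:
  assumes "p \<in> {0..1}" "q \<in> {0..1}" "p \<le> q"
  shows "graph_dist i (geo_coord f i p) (geo_coord f i q) \<le> q - p"
proof -
  have m: "geo_index i p \<le> geo_index i q" unfolding geo_index_def
    using assms by (intro min.mono nat_mono floor_mono mult_left_mono) auto
  show ?thesis
    using geo_index[OF assms(1), of i] geo_index[OF assms(2), of i] assms(3) m
    by (intro graph_dist_le lp_path_geo_coord[of "geo_index i p" "geo_index i q - geo_index i p"]) auto
qed

text \<open>The distances at finite levels increase to \<open>dist\<close>, which is therefore their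
  supremum. These two facts replace the limit from here on.\<close>

lemma graph_dist_le_dist: "graph_dist i (coords x i) (coords y i) \<le> dist x y"
  and dist_leI: "(\<And>i. graph_dist i (coords x i) (coords y i) \<le> c) \<Longrightarrow> dist x y \<le> c"
proof -
  have conv: "(\<lambda>i. graph_dist i (coords x i) (coords y i)) \<longlonglongrightarrow> dist x y"
    unfolding dist_lp_limit_def using graph_dist_coords_convergent convergent_LIMSEQ_iff by blast
  then show "graph_dist i (coords x i) (coords y i) \<le> dist x y"
    using graph_dist_coords_incseq by (intro incseq_le)
  show "(\<And>i. graph_dist i (coords x i) (coords y i) \<le> c) \<Longrightarrow> dist x y \<le> c"
    by (rule LIMSEQ_le_const2[OF conv]) auto
qed

lemma pi0_lipschitz: "\<bar>pi0 x - pi0 y\<bar> \<le> dist x y"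
proof -
  let ?f = "inv_into {0..1} (along [])"
  have f: "?f (along w s) = s" if "length w = 0" "s \<in> {0..1}" for w s
    using that inv_into_f_f[OF inj_on_along_Nil] by simp
  have "\<bar>?f (coords x 0) - ?f (coords y 0)\<bar> / 4 ^ 0 \<le> graph_dist 0 (coords x 0) (coords y 0)"
    by (intro graph_dist_geI coords_X lp_path_lipschitz) (auto simp: f)
  also have "\<dots> \<le> dist x y" by (rule graph_dist_le_dist)
  finally show ?thesis by (simp add: pi0_def)
qed

lemma pi0_geo: "p \<in> {0..1} \<Longrightarrow> pi0 (geo f p) = p"
  unfolding pi0_def coords_geo using geo_coord_eq[of 0 0 p f] inv_into_f_f[OF inj_on_along_Nil]
  by simp

text \<open>The explicit paths along the section bound the distance from above at every level; the
  1-Lipschitz projection bounds it from below.\<close>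

lemma dist_geo:
  assumes "p \<in> {0..1}" "q \<in> {0..1}"
  shows "dist (geo f p) (geo f q) = \<bar>p - q\<bar>"
proof -
  have le: "dist (geo f p) (geo f q) \<le> q - p" if "p \<in> {0..1}" "q \<in> {0..1}" "p \<le> q" for p q
    using that by (intro dist_leI) (simp add: coords_geo graph_dist_geo_coord)
  have "dist (geo f p) (geo f q) \<le> \<bar>p - q\<bar>"
    using le[of p q] le[of q p] assms by (cases "p \<le> q") (auto simp: dist_commute)
  then show ?thesis using pi0_lipschitz[of "geo f p" "geo f q"] assms by (simp add: pi0_geo)
qed

lemma monotone_geodesic_geo: "monotone_geodesic (geo f ` {0..1})"
proof -
  have "geodesic_arc (geo f ` {0..1})"
    unfolding geodesic_arc_def
    by (intro exI[of _ 0] exI[of _ 1] exI[of _ "geo f"]) (auto simp: dist_geo)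
  then show ?thesis
    unfolding monotone_geodesic_def by (auto simp: dist_geo pi0_geo image_image)
qed

section \<open>Sections that separate at a given level\<close>

lemma src_word_cong:
  assumes "\<And>l. l < j \<Longrightarrow> f l = g l"
  shows "word f j n = word g j n" "src (word f (j + d) (n * 4 ^ d)) = src (word g (j + d) (n * 4 ^ d))"
proof -
  show *: "word f j n = word g j n" for n
    using assms by (induction j arbitrary: n) auto
  \<comment> \<open>An index divisible by 4 selects the first quarter \<open>Gsa\<close>, whose
    source is that of the parent edge whatever the flag.\<close>
  show "src (word f (j + d) (n * 4 ^ d)) = src (word g (j + d) (n * 4 ^ d))"
    by (induction d) (auto simp: * lane_def src_Cons simp flip: src_def)
qed

text \<open>Up to level j only the common flags enter. Beyond it the point is the source of an edge
  numbered by a multiple of 4^(i-j), a vertex inherited unchanged from level j.\<close>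

lemma geo_cong:
  assumes fg: "\<And>l. l < j \<Longrightarrow> f l = g l" and n: "n < 4 ^ j"
  shows "geo f (real n / 4 ^ j) = geo g (real n / 4 ^ j)"
proof -
  define p where "p = real n / 4 ^ j"
  have "real n < 4 ^ j" using n by (metis of_nat_less_iff of_nat_numeral of_nat_power)
  then have p: "p \<in> {0..1}" by (auto simp: p_def)
  have "geo_coord f i p = geo_coord g i p" for i
  proof (cases "j \<le> i")
    case True
    define d where "d = i - j"
    have i: "i = j + d" using True by (simp add: d_def)
    have e: "4 ^ i * p = real (n * 4 ^ d)" by (simp add: i p_def power_add)
    have "n * 4 ^ d < 4 ^ i" using n by (simp add: i power_add)
    then have "geo_coord h i p = along (word h i (n * 4 ^ d)) 0" for h
      by (subst geo_coord_eq[of "n * 4 ^ d"]) (auto simp: e)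
    then show ?thesis using src_word_cong(2)[OF fg] by (simp add: along_def i)
  next
    case False
    then show ?thesis using src_word_cong(1)[of i f g] fg by (simp add: geo_coord_def)
  qed
  then show ?thesis by (simp add: geo_def p_def)
qed

lemma graph_dist_vertex_ge:
  assumes x: "Vert u \<in> X_graph i" "Vert v \<in> X_graph i" "u \<noteq> v"
  shows "1 / 4 ^ i \<le> graph_dist i (Vert u) (Vert v)"
proof -
  \<comment> \<open>\<open>f\<close> is the distance to \<open>u\<close> in edge lengths, truncated
    at 1: it is 0 at \<open>u\<close>, 1 at every other vertex, and 1-Lipschitz along each
    edge.\<close>
  define F where "F = (\<lambda>w s::real. min (if src w = u then s else 1) (if tgt w = u then 1 - s else 1))"
  define f where "f = (\<lambda>p. case p of Mid w s \<Rightarrow> F w s | Vert u' \<Rightarrow> if u' = u then 0 else 1)"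
  have f: "f (along w s) = F w s" if "s \<in> {0..1}" for w s
    using that by (auto simp: f_def F_def along_def)
  have "\<bar>f (along w s) - f (along w t)\<bar> \<le> \<bar>s - t\<bar>" if "s \<in> {0..1}" "t \<in> {0..1}" for w s t
    unfolding f[OF that(1)] f[OF that(2)] using that by (auto simp: F_def min_def)
  then have "\<bar>f (Vert u) - f (Vert v)\<bar> / 4 ^ i \<le> graph_dist i (Vert u) (Vert v)"
    using x by (intro graph_dist_geI lp_path_lipschitz) auto
  then show ?thesis using x(3) by (simp add: f_def)
qed

text \<open>Halfway along an edge of X_j the two sections pass through b and b' of the same copy of
  G. These are distinct vertices of X_(j+1), hence at least one edge length apart.\<close>

lemma dist_geo_branch:
  fixes f :: "nat \<Rightarrow> bool"
  assumes fg: "\<And>l. l < j \<Longrightarrow> f l = g l" "f j \<noteq> g j" and n: "n < 4 ^ j"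
    and p: "p = (real n + 1 / 2) / 4 ^ j"
  shows "1 / 4 ^ Suc j \<le> dist (geo f p) (geo g p)"
proof -
  have "real n + 1 \<le> 4 ^ j" using n by (metis Suc_leI of_nat_Suc of_nat_le_iff of_nat_numeral of_nat_power add.commute)
  then have p01: "p \<in> {0..1}" by (auto simp: p)
  have e: "4 ^ Suc j * p = real (4 * n + 2)" by (simp add: p)
  have lt: "4 * n + 2 < 4 ^ Suc j" using n by simp
  \<comment> \<open>The third quarter begins at the middle vertex, so this edge at parameter 0 gives
    b or b'.\<close>
  have w: "word h (Suc j) (4 * n + 2) = lane (h j) 2 # word h j n" for h
  proof -
    have "(4 * n + 2) mod 4 = 2" "(4 * n + 2) div 4 = n" by presburger+
    then show ?thesis by simp
  qed
  have c: "geo_coord h (Suc j) p = Vert (New (word h j n) (if h j then Gb' else Gb))" for h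
    using geo_coord_eq[OF lt, of p h] unfolding w
    by (simp add: e along_def src_Cons lane_def glue_inner del: power_Suc of_nat_add)
  have "1 / 4 ^ Suc j \<le> graph_dist (Suc j) (geo_coord f (Suc j) p) (geo_coord g (Suc j) p)"
    unfolding c using geo_coord_X[OF p01, of f "Suc j", unfolded c] fg(2)
      geo_coord_X[OF p01, of g "Suc j", unfolded c]
    by (intro graph_dist_vertex_ge) auto
  also have "\<dots> \<le> dist (geo f p) (geo g p)"
    using graph_dist_le_dist[of "Suc j" "geo f p" "geo g p"] by (simp only: coords_geo[OF p01])
  finally show ?thesis .
qed

section \<open>Lower bounds for beta numbers\<close>

lemma bounded_lp_limit: "bounded (S :: lp_limit set)"
proof -
  have "dist x y \<le> 2" for x y :: lp_limit
    by (intro dist_leI graph_dist_le_2 coords_X)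
  then show ?thesis unfolding bounded_def by blast
qed

text \<open>If x' and y' on L are close to x and y, their distance equals that of their projections,
  at most dist x x' + dist y y'. The triangle inequality then counts each displacement twice, which
  is where the factor 4 comes from.\<close>

lemma monotone_geodesic_far:
  assumes L: "monotone_geodesic L" and xy: "pi0 x = pi0 y"
  shows "dist x y / 4 \<le> max (infdist x L) (infdist y L)"
proof (rule ccontr)
  assume "\<not> ?thesis"
  then have a: "infdist x L < dist x y / 4" "infdist y L < dist x y / 4" by auto
  have ne: "L \<noteq> {}" using L by (auto simp: monotone_geodesic_def)
  obtain x' where x': "x' \<in> L" "dist x x' < dist x y / 4"
    using a(1) ne by (metis infdist_notempty cINF_less_iff bdd_below_image_dist)
  obtain y' where y': "y' \<in> L" "dist y y' < dist x y / 4"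
    using a(2) ne by (metis infdist_notempty cINF_less_iff bdd_below_image_dist)
  have "dist x' y' = \<bar>pi0 x' - pi0 y'\<bar>" using L x' y' by (simp add: monotone_geodesic_def)
  also have "\<dots> \<le> dist x x' + dist y y'"
    using pi0_lipschitz[of x x'] pi0_lipschitz[of y y'] xy by linarith
  finally have "dist x' y' \<le> dist x x' + dist y y'" .
  moreover have "dist x y \<le> dist x x' + dist x' y' + dist y y'" by metric
  ultimately show False using x' y' by linarith
qed

lemma beta_ge:
  assumes "x \<in> E \<inter> B" "y \<in> E \<inter> B" and xy: "pi0 x = pi0 y" and neq: "x \<noteq> y"
  shows "dist x y / 4 \<le> beta E B * diameter B"
proof -
  have "dist x y \<le> diameter B" using assms by (intro diameter_bounded_bound bounded_lp_limit) auto
  then have d: "diameter B > 0" using neq by (metis less_le_trans zero_less_dist_iff)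
  have "dist x y / 4 \<le> (INF L\<in>{L. monotone_geodesic L}.
        if E \<inter> B = {} then 0 else SUP x\<in>E \<inter> B. infdist x L)"
  proof (rule cINF_greatest)
    show "{L. monotone_geodesic L} \<noteq> {}" using monotone_geodesic_geo by blast
    fix L assume "L \<in> {L. monotone_geodesic L}"
    then have L: "monotone_geodesic L" by simp
    then have "L \<noteq> {}" by (auto simp: monotone_geodesic_def)
    then obtain l where l: "l \<in> L" by blast
    \<comment> \<open>A real \<open>SUP\<close> is an upper bound only for bounded families; all
      distances in the limit are at most 2.\<close>
    have "infdist z L \<le> 2" for z
      using infdist_le[OF l, of z] dist_leI[of z l 2] graph_dist_le_2[OF coords_X coords_X]
      by fastforce
    then have "bdd_above ((\<lambda>z. infdist z L) ` (E \<inter> B))" by (auto intro!: bdd_aboveI)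
    then have "infdist x L \<le> (SUP z\<in>E \<inter> B. infdist z L)" "infdist y L \<le> (SUP z\<in>E \<inter> B. infdist z L)"
      using assms(1,2) by (auto intro: cSUP_upper)
    then show "dist x y / 4 \<le> (if E \<inter> B = {} then 0 else SUP x\<in>E \<inter> B. infdist x L)"
      using monotone_geodesic_far[OF L xy] assms(1) by auto
  qed
  then show ?thesis using d by (simp add: beta_def)
qed

section \<open>Lipschitz curves\<close>

text \<open>Cutting the parameter interval into n equal pieces, with l / n below the mesh bound,
  gives a cover with diameters summing to at most l.\<close>

lemma hausdorff1_lipschitz_image:
  fixes \<gamma> :: "real \<Rightarrow> 'a::metric_space"
  assumes \<gamma>: "1-lipschitz_on {0..l} \<gamma>" and l: "0 \<le> l"
  shows "hausdorff1 (\<gamma> ` {0..l}) \<le> ennreal l"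
  unfolding hausdorff1_def
proof (rule SUP_least)
  fix \<delta> :: real assume "\<delta> \<in> {0<..}"
  then have "\<delta> > 0" by simp
  then obtain n where n: "n > 0" "l / \<delta> < real n"
    by (metis reals_Archimedean2 gr0I less_trans less_numeral_extra(3) divide_nonneg_pos l not_less of_nat_0)
  define I where "I = (\<lambda>i. {real i * l / n .. real (Suc i) * l / n} \<inter> {0..l})"
  \<comment> \<open>Covers are infinite sequences, so the finite one is padded with empty sets, of
    diameter 0.\<close>
  define U where "U = (\<lambda>i. if i < n then \<gamma> ` I i else {})"
  have dI: "dist (\<gamma> s) (\<gamma> t) \<le> l / n" if "s \<in> I i" "t \<in> I i" for s t i
  proof -
    have "s \<in> {0..l}" "t \<in> {0..l}" using that unfolding I_def by blast+
    then have "dist (\<gamma> s) (\<gamma> t) \<le> \<bar>s - t\<bar>"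
      using lipschitz_onD[OF \<gamma>, of s t] by (simp add: dist_real_def)
    moreover have "real (Suc i) * l / n = real i * l / n + l / n" by (simp add: distrib_right add_divide_distrib)
    ultimately show ?thesis using that by (auto simp: I_def)
  qed
  have ln: "0 \<le> l / n" "l / n \<le> \<delta>" using n \<open>\<delta> > 0\<close> l by (auto simp: field_simps)
  have U: "bounded (U i) \<and> diameter (U i) \<le> l / n" for i
  proof
    show "bounded (U i)" unfolding U_def bounded_def using dI by (auto; blast)
    show "diameter (U i) \<le> l / n"
      using ln(1) dI by (auto simp: diameter_def U_def intro!: cSUP_least)
  qed
  have "\<gamma> ` {0..l} \<subseteq> (\<Union>i. U i)"
  proof
    fix y assume "y \<in> \<gamma> ` {0..l}"
    then obtain t where t: "t \<in> {0..l}" "y = \<gamma> t" by auto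
    have "\<exists>i<n. t \<in> I i"
    \<comment> \<open>The right endpoint needs the last piece, since rounding down would give n.
      This case also absorbs l = 0, so that the other may divide by l.\<close>
    proof (cases "t = l")
      case True
      have "real (n - 1) * l / n \<le> l" using n l by (simp add: field_simps of_nat_diff)
      then show ?thesis using True n l by (intro exI[of _ "n - 1"]) (auto simp: I_def)
    next
      case False
      then have l: "l > 0" "t < l" "0 \<le> t" using t by auto
      define i where "i = nat \<lfloor>t * n / l\<rfloor>"
      have "0 \<le> t * n / l" using l by simp
      then have "real i \<le> t * n / l" "t * n / l < real (Suc i)" unfolding i_def by linarith+
      then have i: "real i * l \<le> t * n" "t * n < real (Suc i) * l"
        using l by (auto simp: field_simps)
      have "t * n < l * n" using l n by simp
      then have "real i * l < real n * l" using i by (simp add: mult.commute)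
      then have "i < n" using l by simp
      then show ?thesis using i n t by (intro exI[of _ i]) (auto simp: I_def field_simps)
    qed
    then show "y \<in> (\<Union>i. U i)" using t by (auto simp: U_def)
  qed
  then have "hausdorff1_delta \<delta> (\<gamma> ` {0..l}) \<le> (\<Sum>i. ennreal (diameter (U i)))"
    unfolding hausdorff1_delta_def using U ln by (intro INF_lower) (auto intro: order_trans)
  also have "\<dots> = (\<Sum>i<n. ennreal (diameter (U i)))"
    by (rule suminf_finite) (auto simp: U_def)
  also have "\<dots> \<le> (\<Sum>i<n. ennreal (l / n))"
    using U by (intro sum_mono ennreal_leI) auto
  also have "\<dots> = ennreal (\<Sum>i<n. l / n)" using ln by (intro sum_ennreal)
  also have "\<dots> = ennreal l" using n by simp
  finally show "hausdorff1_delta \<delta> (\<gamma> ` {0..l}) \<le> ennreal l" .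
qed

lemma rectifiable_curve_lipschitz_image:
  fixes \<gamma> :: "real \<Rightarrow> 'a::metric_space"
  assumes \<gamma>: "1-lipschitz_on {0..l} \<gamma>" and l: "0 \<le> l"
  shows "rectifiable_curve (\<gamma> ` {0..l})"
proof -
  define \<eta> where "\<eta> = (\<lambda>t. \<gamma> (l * t))"
  have "l-lipschitz_on {0..1} \<eta>"
  proof (rule lipschitz_onI)
    fix s t :: real assume "s \<in> {0..1}" "t \<in> {0..1}"
    then have "dist (\<eta> s) (\<eta> t) \<le> dist (l * s) (l * t)" unfolding \<eta>_def
      using lipschitz_onD[OF \<gamma>, of "l * s" "l * t"] l by (auto simp: mult_left_le)
    then show "dist (\<eta> s) (\<eta> t) \<le> l * dist s t"
      using l by (simp add: dist_real_def abs_mult flip: right_diff_distrib)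
  qed (use l in auto)
  note \<eta> = this
  have "(\<Sum>i<n. dist (\<eta> (t i)) (\<eta> (t (Suc i)))) \<le> l"
    if t: "mono t" "range t \<subseteq> {0..1}" for n and t :: "nat \<Rightarrow> real"
  proof -
    have "dist (\<eta> (t i)) (\<eta> (t (Suc i))) \<le> l * (t (Suc i) - t i)" for i
      using lipschitz_onD[OF \<eta>, of "t i" "t (Suc i)"] t(2) monoD[OF t(1), of i "Suc i"]
      by (simp add: dist_real_def abs_if image_subset_iff split: if_splits)
    then have "(\<Sum>i<n. dist (\<eta> (t i)) (\<eta> (t (Suc i)))) \<le> (\<Sum>i<n. l * (t (Suc i) - t i))"
      by (intro sum_mono)
    also have "\<dots> = l * (t n - t 0)" by (simp add: sum_lessThan_telescope flip: sum_distrib_left)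
    also have "\<dots> \<le> l * 1" using t(2) l by (intro mult_left_mono) (auto simp: image_subset_iff diff_le_eq intro: add_increasing2)
    finally show ?thesis by simp
  qed
  moreover have "path \<eta>" unfolding path_def using \<eta> by (rule lipschitz_on_continuous_on)
  moreover have "path_image \<eta> = \<gamma> ` {0..l}"
  proof -
    have "(\<lambda>t. l * t) ` {0..1} = {0..l}" using l by (cases "l = 0") (auto simp: image_mult_atLeastAtMost image_constant_conv)
    then show ?thesis unfolding path_image_def \<eta>_def by (metis image_image)
  qed
  ultimately show ?thesis unfolding rectifiable_curve_def rectifiable_path_def by blast
qed

section \<open>Attaching detours to a curve\<close>

lemma insert_detour:
  fixes \<gamma> \<eta> :: "real \<Rightarrow> 'a::metric_space"
  assumes \<gamma>: "1-lipschitz_on {0..l} \<gamma>" and \<eta>: "1-lipschitz_on {0..c} \<eta>"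
    and s: "s \<in> {0..l}" "\<gamma> s = \<eta> 0" and c: "0 \<le> c"
  shows "\<exists>\<gamma>'. 1-lipschitz_on {0..l + 2 * c} \<gamma>' \<and> insert (\<eta> c) (\<gamma> ` {0..l}) \<subseteq> \<gamma>' ` {0..l + 2 * c}"
proof -
  \<comment> \<open>\<open>h1\<close> follows the curve up to time s and then runs out along the
    detour; \<open>h2\<close> returns from its tip by time s + 2c and resumes the curve with its
    clock shifted by 2c.\<close>
  define h1 where "h1 = (\<lambda>t. if t \<le> s then \<gamma> t else \<eta> (t - s))"
  define h2 where "h2 = (\<lambda>t. if t \<le> s + 2 * c then \<eta> (s + 2 * c - t) else \<gamma> (t - 2 * c))"
  define h where "h = (\<lambda>t. if t \<le> s + c then h1 t else h2 t)"
  have 1: "1-lipschitz_on {0..s + c} h1" unfolding h1_def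
    using s c by (intro lipschitz_on_concat lipschitz_on_subset[OF \<gamma>])
      (auto intro!: lipschitz_onI lipschitz_onD[OF \<eta>, THEN order_trans] simp: dist_real_def)
  have 2: "1-lipschitz_on {s + c..l + 2 * c} h2" unfolding h2_def
    using s c by (intro lipschitz_on_concat)
      (auto intro!: lipschitz_onI lipschitz_onD[OF \<eta>, THEN order_trans] lipschitz_onD[OF \<gamma>, THEN order_trans] simp: dist_real_def)
  have m: "h1 (s + c) = h2 (s + c)" using c s by (auto simp: h1_def h2_def)
  have h: "1-lipschitz_on {0..l + 2 * c} h" unfolding h_def
    using lipschitz_on_concat[OF 1 2 m] .
  have "\<gamma> t \<in> h ` {0..l + 2 * c}" if "t \<in> {0..l}" for t
  proof (cases "t \<le> s")
    case True
    then have "h t = \<gamma> t" using c by (simp add: h_def h1_def)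
    then show ?thesis using that c by (intro image_eqI[of _ _ t]) auto
  next
    case False
    then have "h (t + 2 * c) = \<gamma> t" using c by (simp add: h_def h2_def)
    then show ?thesis using that c by (intro image_eqI[of _ _ "t + 2 * c"]) auto
  qed
  moreover have "h (s + c) = \<eta> c" using c s by (auto simp: h_def h1_def)
  then have "\<eta> c \<in> h ` {0..l + 2 * c}" using s c by (intro image_eqI[of _ _ "s + c"]) auto
  ultimately show ?thesis using h by blast
qed

text \<open>Each insertion keeps the whole previous image, so the base points on the original curve
  remain available for later detours.\<close>

lemma insert_detours:
  fixes \<gamma> :: "real \<Rightarrow> 'a::metric_space"
  assumes "finite D" "1-lipschitz_on {0..l} \<gamma>" "0 \<le> l"
    and "\<And>d. d \<in> D \<Longrightarrow> 0 \<le> c d \<and> 1-lipschitz_on {0..c d} (\<eta> d) \<and> \<eta> d 0 \<in> \<gamma> ` {0..l}"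
  shows "\<exists>\<gamma>'. 1-lipschitz_on {0..l + (\<Sum>d\<in>D. 2 * c d)} \<gamma>' \<and>
    (\<lambda>d. \<eta> d (c d)) ` D \<union> \<gamma> ` {0..l} \<subseteq> \<gamma>' ` {0..l + (\<Sum>d\<in>D. 2 * c d)}"
  using assms
proof (induction D rule: finite_induct)
  case empty
  then show ?case by auto
next
  case (insert d D)
  let ?l = "l + (\<Sum>d\<in>D. 2 * c d)"
  obtain \<gamma>' where \<gamma>': "1-lipschitz_on {0..?l} \<gamma>'" 
    "(\<lambda>d. \<eta> d (c d)) ` D \<union> \<gamma> ` {0..l} \<subseteq> \<gamma>' ` {0..?l}"
    using insert by auto
  have "\<eta> d 0 \<in> \<gamma>' ` {0..?l}" using \<gamma>'(2) insert.prems by blast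
  then obtain s where s: "s \<in> {0..?l}" "\<gamma>' s = \<eta> d 0" by auto
  have "?l + 2 * c d = l + (\<Sum>d\<in>insert d D. 2 * c d)" using insert by simp
  moreover have "1-lipschitz_on {0..c d} (\<eta> d)" "0 \<le> c d" using insert.prems by auto
  ultimately obtain \<gamma>'' where \<gamma>'': "1-lipschitz_on {0..l + (\<Sum>d\<in>insert d D. 2 * c d)} \<gamma>''"
    "insert (\<eta> d (c d)) (\<gamma>' ` {0..?l}) \<subseteq> \<gamma>'' ` {0..l + (\<Sum>d\<in>insert d D. 2 * c d)}"
    using insert_detour[where \<gamma> = \<gamma>' and \<eta> = "\<eta> d" and l = ?l and c = "c d"] \<gamma>'(1) s by metis
  have "(\<lambda>d. \<eta> d (c d)) ` insert d D \<union> \<gamma> ` {0..l} \<subseteq> insert (\<eta> d (c d)) (\<gamma>' ` {0..?l})"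
    using \<gamma>'(2) by auto
  then show ?case using \<gamma>'' by (meson subset_trans)
qed

section \<open>The counterexample\<close>

text \<open>The point (u + 1/4) / 4^k. As 4u + 1 is not divisible by 4, it has level k + 1 and no
  lower level, which tells the generations apart.\<close>

definition base_point :: "nat \<Rightarrow> nat \<Rightarrow> real" where
  "base_point k u = real (4 * u + 1) / 4 ^ Suc k"

lemma base_point_inj:
  assumes "base_point k u = base_point k' u'"
  shows "k = k' \<and> u = u'"
proof -
  have *: "\<not> k < k'" if e: "(4 * u + 1) * 4 ^ k' = (4 * u' + 1) * 4 ^ k" for u k u' k' :: nat
  proof
    assume "k < k'"
    define d where "d = k' - Suc k"
    have "k' = Suc k + d" using \<open>k < k'\<close> by (simp add: d_def)
    then have "(4::nat) ^ k' = 4 * 4 ^ d * 4 ^ k" by (simp add: power_add)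
    then have "((4 * u + 1) * (4 * 4 ^ d)) * 4 ^ k = (4 * u' + 1) * 4 ^ k"
      using e by (simp only: mult.assoc)
    then have "(4 * u + 1) * (4 * 4 ^ d) = 4 * u' + 1" by (subst (asm) mult_right_cancel) simp_all
    moreover have "4 dvd (4 * u + 1) * (4 * 4 ^ d)" by (intro dvd_mult dvd_triv_left)
    ultimately have "4 dvd 4 * u' + 1" by (simp only:)
    then show False by presburger
  qed
  have "real ((4 * u + 1) * 4 ^ k') = real ((4 * u' + 1) * 4 ^ k)"
  proof -
    have "real (4 * u + 1) * 4 ^ Suc k' = real (4 * u' + 1) * 4 ^ Suc k"
      using assms unfolding base_point_def by (subst (asm) frac_eq_eq) simp_all
    then have "4 * (real (4 * u + 1) * 4 ^ k') = 4 * (real (4 * u' + 1) * 4 ^ k)"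
      unfolding power_Suc by (simp only: mult.left_commute)
    then show ?thesis by (simp only: of_nat_mult of_nat_power of_nat_numeral)
  qed
  then have e: "(4 * u + 1) * 4 ^ k' = (4 * u' + 1) * 4 ^ k" by (simp only: of_nat_eq_iff)
  then have "k = k'" using *[OF e] *[OF e[symmetric]] by simp
  then show ?thesis using e by simp
qed

text \<open>The ball projects into the interval because \<open>pi0\<close> is 1-Lipschitz, and
  \<open>geo f\<close> lifts the interval back into the ball. Staying inside [0,1] avoids
  truncation, so centre and radius can be read off the image.\<close>

lemma pi0_ball_geo:
  assumes "0 < r" "r \<le> p" "p \<le> 1 - r"
  shows "pi0 ` ball (geo f p) r = {p - r<..<p + r}"
proof -
  have p: "p \<in> {0..1}" using assms by auto
  have "q \<in> pi0 ` ball (geo f p) r" if "q \<in> {p - r<..<p + r}" for q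
    using that assms p by (intro image_eqI[of _ _ "geo f q"]) (auto simp: pi0_geo dist_geo)
  moreover have "pi0 x \<in> {p - r<..<p + r}" if "x \<in> ball (geo f p) r" for x
    using that pi0_lipschitz[of "geo f p" x] p by (auto simp: pi0_geo)
  ultimately show ?thesis by blast
qed

text \<open>This margin at both ends of [0,1] gives room for the detours and for the balls in
  \<open>inj_on_balls\<close>.\<close>

lemma base_point_bounds:
  assumes "u < 4 ^ k"
  shows "1 / 4 ^ Suc k \<le> base_point k u" "base_point k u \<le> 1 - 1 / 4 ^ Suc k"
proof -
  have "4 * u + 1 + 1 \<le> 4 ^ Suc k" using assms by simp
  then have "real (4 * u + 1 + 1) \<le> real (4 ^ Suc k)" by (rule of_nat_mono)
  then have "real (4 * u + 1) + 1 \<le> 4 ^ Suc k" by simp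
  then have "(real (4 * u + 1) + 1) / 4 ^ Suc k \<le> 1" by (subst divide_le_eq_1_pos) simp_all
  then show "base_point k u \<le> 1 - 1 / 4 ^ Suc k"
    unfolding base_point_def add_divide_distrib by linarith
  show "1 / 4 ^ Suc k \<le> base_point k u" unfolding base_point_def by (intro divide_right_mono) auto
qed

lemma base_point_in: "u < 4 ^ k \<Longrightarrow> base_point k u \<in> {0..1}"
proof -
  assume "u < 4 ^ k"
  moreover have "0 < 1 / (4::real) ^ Suc k" by simp
  ultimately show ?thesis
    using base_point_bounds[of u k] unfolding atLeastAtMost_iff by linarith
qed

lemma detoured_curve:
  assumes m: "0 < m"
  obtains \<gamma> :: "real \<Rightarrow> lp_limit" where "1-lipschitz_on {0..2} \<gamma>"
    "\<And>k u. k < 4 ^ m \<Longrightarrow> u < 4 ^ k \<Longrightarrow> \<exists>x\<in>\<gamma> ` {0..2}. \<exists>y\<in>\<gamma> ` {0..2}.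
       pi0 x = pi0 y \<and> 1 / 4 ^ Suc (k + m) \<le> dist x y \<and>
       dist (geo (\<lambda>_. False) (base_point k u)) x < 1 / 4 ^ (k + m) \<and>
       dist (geo (\<lambda>_. False) (base_point k u)) y < 1 / 4 ^ (k + m)"
proof -
  let ?F = "\<lambda>_::nat. False"
  define D where "D = (SIGMA k:{..<4 ^ m :: nat}. {..<4 ^ k :: nat})"
  \<comment> \<open>Half an edge of level k + m: the detour stops halfway between two vertices, at
    b'.\<close>
  define c where "c = (\<lambda>(k, u::nat). 1 / (2 * 4 ^ (k + m)) :: real)"
  \<comment> \<open>The flag sequence that takes b' only in the copies of G replacing edges of
    X_(k+m).\<close>
  define J where "J = (\<lambda>k l. l = k + m)"
  define \<eta> where "\<eta> = (\<lambda>(k, u) t. geo (J k) (base_point k u + t))"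
  have range: "base_point k u \<in> {0..1}" "base_point k u + c (k, u) \<in> {0..1}" if "u < 4 ^ k" for k u
  proof -
    have "(1::real) / (2 * 4 ^ (k + m)) \<le> 1 / 4 ^ Suc k"
    proof (intro divide_left_mono)
      have "(4::real) ^ Suc k \<le> 4 ^ (k + m)" using m by (intro power_increasing) auto
      moreover have "(0::real) \<le> 4 ^ (k + m)" by simp
      ultimately show "(4::real) ^ Suc k \<le> 2 * 4 ^ (k + m)" by linarith
    qed auto
    then have "c (k, u) \<le> 1 / 4 ^ Suc k" unfolding c_def by simp
    moreover have "0 \<le> c (k, u)" by (simp add: c_def)
    ultimately show "base_point k u \<in> {0..1}" "base_point k u + c (k, u) \<in> {0..1}"
      using base_point_bounds[OF that] base_point_in[OF that] unfolding atLeastAtMost_iff by linarith+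
  qed
  have split: "geo (J k) (base_point k u) = geo ?F (base_point k u)"
    "1 / 4 ^ Suc (k + m) \<le> dist (geo ?F (base_point k u + c (k, u))) (geo (J k) (base_point k u + c (k, u)))"
    if u: "u < 4 ^ k" for k u
  proof -
    \<comment> \<open>The base point has level k + 1, at most k + m since m > 0; \<open>n\<close> is
      its index among the vertices of level k + m.\<close>
    define n where "n = (4 * u + 1) * 4 ^ (m - 1)"
    have "(4 * u + 1) * 4 ^ (m - 1) < 4 ^ Suc k * 4 ^ (m - 1)" using u by (intro mult_strict_right_mono) auto
    moreover have "(4::nat) ^ Suc k * 4 ^ (m - 1) = 4 ^ (k + m)"
      unfolding power_add[symmetric] using m by simp
    ultimately have n: "n < 4 ^ (k + m)" by (simp add: n_def)
    have km: "(4::real) ^ (k + m) = 4 ^ Suc k * 4 ^ (m - 1)"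
      unfolding power_add[symmetric] using m by simp
    have b: "base_point k u = real n / 4 ^ (k + m)"
      unfolding km base_point_def n_def of_nat_mult of_nat_power by simp
    then show "geo (J k) (base_point k u) = geo ?F (base_point k u)"
      using n by (auto simp: J_def intro: geo_cong)
    have "base_point k u + c (k, u) = (real n + 1 / 2) / 4 ^ (k + m)"
      by (simp add: b c_def add_divide_distrib)
    then show "1 / 4 ^ Suc (k + m) \<le> dist (geo ?F (base_point k u + c (k, u))) (geo (J k) (base_point k u + c (k, u)))"
      by (intro dist_geo_branch[of "k + m" _ _ n] n) (auto simp: J_def)
  qed
  have "1-lipschitz_on {0..c d} (\<eta> d) \<and> \<eta> d 0 \<in> geo ?F ` {0..1} \<and> 0 \<le> c d" if "d \<in> D" for d
  proof -
    obtain k u where d: "d = (k, u)" "u < 4 ^ k"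
    proof -
      obtain k u where "d = (k, u)" by (metis prod.exhaust)
      then show ?thesis using that[of k u] \<open>d \<in> D\<close> by (auto simp: D_def)
    qed
    have "base_point k u + t \<in> {0..1}" if "t \<in> {0..c (k, u)}" for t
      using range[OF d(2)] that by auto
    then have "1-lipschitz_on {0..c d} (\<eta> d)"
      by (intro lipschitz_onI) (auto simp: \<eta>_def d dist_geo dist_real_def)
    moreover have "\<eta> d 0 \<in> geo ?F ` {0..1}"
      using range(1)[OF d(2)] split(1)[OF d(2)] by (auto simp: \<eta>_def d)
    ultimately show ?thesis by (simp add: d c_def)
  qed
  moreover have "1-lipschitz_on {0..1} (geo ?F)"
    by (intro lipschitz_onI) (auto simp: dist_geo dist_real_def)
  moreover have "finite D" by (simp add: D_def)
  ultimately obtain \<gamma> where \<gamma>: "1-lipschitz_on {0..1 + (\<Sum>d\<in>D. 2 * c d)} \<gamma>"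
    "(\<lambda>d. \<eta> d (c d)) ` D \<union> geo ?F ` {0..1} \<subseteq> \<gamma> ` {0..1 + (\<Sum>d\<in>D. 2 * c d)}"
    using insert_detours[of D 1 "geo ?F" c \<eta>] by auto
  have "(\<Sum>d\<in>D. 2 * c d) = (\<Sum>k<4 ^ m. \<Sum>u<(4::nat) ^ k. 2 * c (k, u))"
    unfolding D_def by (subst sum.Sigma) auto
  also have "\<dots> = (\<Sum>k<4 ^ m. \<Sum>u<(4::nat) ^ k. 1 / 4 ^ (k + m))"
    by (simp add: c_def)
  also have "\<dots> = 1" by (simp add: power_add)
  finally have len: "1 + (\<Sum>d\<in>D. 2 * c d) = 2" by simp
  note \<gamma> = \<gamma>[unfolded len]
  have "\<exists>x\<in>\<gamma> ` {0..2}. \<exists>y\<in>\<gamma> ` {0..2}.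
       pi0 x = pi0 y \<and> 1 / 4 ^ Suc (k + m) \<le> dist x y \<and>
       dist (geo ?F (base_point k u)) x < 1 / 4 ^ (k + m) \<and>
       dist (geo ?F (base_point k u)) y < 1 / 4 ^ (k + m)" if ku: "k < 4 ^ m" "u < 4 ^ k" for k u
  proof (intro bexI conjI)
    note R = range[OF ku(2)] and S = split[OF ku(2)]
    \<comment> \<open>The tip \<open>?y\<close> of the detour and the point \<open>?x\<close> of the
      undetoured geodesic with the same projection.\<close>
    let ?x = "geo ?F (base_point k u + c (k, u))" and ?y = "\<eta> (k, u) (c (k, u))"
    have y: "?y = geo (J k) (base_point k u + c (k, u))" by (simp add: \<eta>_def)
    have c: "\<bar>base_point k u - (base_point k u + c (k, u))\<bar> < 1 / 4 ^ (k + m)"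
      by (simp add: c_def divide_strict_left_mono)
    show "pi0 ?x = pi0 ?y" unfolding y using R by (simp add: pi0_geo)
    show "1 / 4 ^ Suc (k + m) \<le> dist ?x ?y" unfolding y by (rule S)
    show "dist (geo ?F (base_point k u)) ?x < 1 / 4 ^ (k + m)"
      unfolding dist_geo[OF R] by (rule c)
    show "dist (geo ?F (base_point k u)) ?y < 1 / 4 ^ (k + m)"
      unfolding y S(1)[symmetric] dist_geo[OF R] by (rule c)
    show "?x \<in> \<gamma> ` {0..2}" using \<gamma>(2) R by blast
    have "(k, u) \<in> D" using ku by (simp add: D_def)
    then show "?y \<in> \<gamma> ` {0..2}" using \<gamma>(2) by blast
  qed
  then show ?thesis using that \<gamma>(1) by blast
qed

text \<open>The sum runs over balls as sets, so coinciding balls would count once. The projected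
  interval determines the base point, hence k and u, and the radius, hence g; the condition on
  \<open>g0\<close> keeps the radius below the margin 4^(-k-1).\<close>

lemma inj_on_balls:
  assumes A: "0 < A" "4 * A \<le> 4 ^ g0"
  shows "inj_on (\<lambda>((k, u), g). ball (geo (\<lambda>_. False) (base_point k u)) (A / 4 ^ (k + g)))
    ((SIGMA k:K. {..<4 ^ k}) \<times> {g0..m})"
proof (rule inj_onI, goal_cases)
  case (1 s s')
  obtain k u g k' u' g' where s: "s = ((k, u), g)" "s' = ((k', u'), g')"
    by (metis prod.exhaust)
  have u: "u < 4 ^ k" "u' < 4 ^ k'" and g: "g0 \<le> g" "g0 \<le> g'"
    and eq: "ball (geo (\<lambda>_. False) (base_point k u)) (A / 4 ^ (k + g)) =
      ball (geo (\<lambda>_. False) (base_point k' u')) (A / 4 ^ (k' + g'))"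
    using 1 by (auto simp: s)
  have pi0: "pi0 ` ball (geo (\<lambda>_. False) (base_point k u)) (A / 4 ^ (k + g)) =
      {base_point k u - A / 4 ^ (k + g)<..<base_point k u + A / 4 ^ (k + g)}"
    if "u < 4 ^ k" "g0 \<le> g" for k u g
  proof (rule pi0_ball_geo)
    have "(4::real) ^ g0 \<le> 4 ^ g" using that(2) by (intro power_increasing) auto
    then have "4 * A \<le> 4 ^ g" using A(2) by linarith
    then have "A / 4 ^ (k + g) \<le> 1 / 4 ^ Suc k" by (simp add: power_add field_simps)
    then show "A / 4 ^ (k + g) \<le> base_point k u" "base_point k u \<le> 1 - A / 4 ^ (k + g)"
      using base_point_bounds[OF that(1)] by linarith+
  qed (use A in auto)
  have pos: "0 < A / 4 ^ i" for i using A by simp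
  define p p' r r' where "p = base_point k u" and "p' = base_point k' u'"
    and "r = A / 4 ^ (k + g)" and "r' = A / 4 ^ (k' + g')"
  have "{p - r<..<p + r} = {p' - r'<..<p' + r'}"
    using pi0[of u k g] pi0[of u' k' g'] u g eq by (simp add: p_def p'_def r_def r'_def)
  moreover have "0 < r" "0 < r'" by (simp_all add: r_def r'_def pos)
  ultimately have "p - r = p' - r'" "p + r = p' + r'"
    by (simp_all add: set_eq_subset greaterThanLessThan_subseteq_greaterThanLessThan)
  then have "p = p'" "r = r'" by linarith+
  then have "k = k' \<and> u = u'" "4 ^ (k + g) = (4 ^ (k' + g') :: real)"
    using base_point_inj A(1) by (simp_all add: p_def p'_def r_def r'_def)
  then show ?case by (simp add: s)
qed

theorem proposition7p1:
  fixes A :: real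
  assumes "A > 1"
  shows "\<not> (\<exists>C::real. C > 0 \<and>
    (\<forall>\<Gamma> :: lp_limit set. rectifiable_curve \<Gamma> \<longrightarrow>
      (\<Sum>\<^sub>\<infinity>B\<in>vertex_balls A. ennreal (beta \<Gamma> B * diameter B)) \<le> ennreal C * hausdorff1 \<Gamma>))"
proof
  assume "\<exists>C::real. C > 0 \<and>
    (\<forall>\<Gamma> :: lp_limit set. rectifiable_curve \<Gamma> \<longrightarrow>
      (\<Sum>\<^sub>\<infinity>B\<in>vertex_balls A. ennreal (beta \<Gamma> B * diameter B)) \<le> ennreal C * hausdorff1 \<Gamma>)"
  then obtain C :: real where C: "C > 0" "\<And>\<Gamma> :: lp_limit set. rectifiable_curve \<Gamma> \<Longrightarrow>
      (\<Sum>\<^sub>\<infinity>B\<in>vertex_balls A. ennreal (beta \<Gamma> B * diameter B)) \<le> ennreal C * hausdorff1 \<Gamma>"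
    by blast
  obtain g0 where g0: "4 * A \<le> 4 ^ g0"
    using real_arch_pow[of 4 "4 * A"] by (auto intro: less_imp_le)
  \<comment> \<open>With g > 0 the base points, of level k + 1, are also vertices of level k +
    g.\<close>
  have "g0 \<noteq> 0" using g0 assms by (intro notI) auto
  then have g0_pos: "0 < g0" by simp
  \<comment> \<open>Chosen so that the lower bound (M + 1) / 16 for the sum exceeds the upper bound
    2C. The scales g0, ..., m number M + 1.\<close>
  obtain M :: nat where M: "32 * C < real M" using reals_Archimedean2 by blast
  define m where "m = g0 + M"
  have "0 < m" using g0_pos by (simp add: m_def)
  then obtain \<gamma> :: "real \<Rightarrow> lp_limit" where \<gamma>: "1-lipschitz_on {0..2} \<gamma>"
    "\<And>k u. k < 4 ^ m \<Longrightarrow> u < 4 ^ k \<Longrightarrow> \<exists>x\<in>\<gamma> ` {0..2}. \<exists>y\<in>\<gamma> ` {0..2}.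
       pi0 x = pi0 y \<and> 1 / 4 ^ Suc (k + m) \<le> dist x y \<and>
       dist (geo (\<lambda>_. False) (base_point k u)) x < 1 / 4 ^ (k + m) \<and>
       dist (geo (\<lambda>_. False) (base_point k u)) y < 1 / 4 ^ (k + m)"
    using detoured_curve by blast
  define \<Gamma> where "\<Gamma> = \<gamma> ` {0..2}"
  define D where "D = (SIGMA k:{..<4 ^ m :: nat}. {..<4 ^ k :: nat})"
  define S where "S = D \<times> {g0..m}"
  define B where "B = (\<lambda>((k, u), g). ball (geo (\<lambda>_. False) (base_point k u)) (A / 4 ^ (k + g)))"
  have "finite S" by (simp add: S_def D_def)
  have inj: "inj_on B S" unfolding B_def S_def D_def
    using assms g0 by (intro inj_on_balls) auto
  have vertex: "B s \<in> vertex_balls A" if "s \<in> S" for s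
  proof -
    obtain k u g where s: "s = ((k, u), g)" "u < 4 ^ k" "0 < g"
    proof -
      obtain k u g where "s = ((k, u), g)" by (metis prod.exhaust)
      then show ?thesis using that[of k u g] \<open>s \<in> S\<close> g0_pos by (auto simp: S_def D_def)
    qed
    have "base_point k u \<in> {0..1}" using base_point_in[OF s(2)] .
    moreover have "base_point k u = of_int (int ((4 * u + 1) * 4 ^ (g - 1))) / 4 ^ (k + g)"
    proof -
      have "(4::real) ^ (k + g) = 4 ^ Suc k * 4 ^ (g - 1)" unfolding power_add[symmetric] using s(3) by simp
      then show ?thesis unfolding base_point_def by (simp only: of_int_of_nat_eq of_nat_mult of_nat_power of_nat_numeral) simp
    qed
    ultimately have "vertex_of_level (k + g) (geo (\<lambda>_. False) (base_point k u))"
      unfolding vertex_of_level_def by (metis pi0_geo)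
    then show ?thesis unfolding vertex_balls_def B_def s(1) by auto
  qed
  \<comment> \<open>Of the extra exponent 2, one factor 1/4 is the gap between the branches and the
    other comes from \<open>beta_ge\<close>.\<close>
  have term_ge: "1 / 4 ^ (fst (fst s) + m + 2) \<le> beta \<Gamma> (B s) * diameter (B s)" if "s \<in> S" for s
  proof -
    obtain k u g where s: "s = ((k, u), g)" "k < 4 ^ m" "u < 4 ^ k" "g \<le> m"
    proof -
      obtain k u g where "s = ((k, u), g)" by (metis prod.exhaust)
      then show ?thesis using that[of k u g] \<open>s \<in> S\<close> by (auto simp: S_def D_def)
    qed
    obtain x y where xy: "x \<in> \<Gamma>" "y \<in> \<Gamma>" "pi0 x = pi0 y" "1 / 4 ^ Suc (k + m) \<le> dist x y"
      "dist (geo (\<lambda>_. False) (base_point k u)) x < 1 / 4 ^ (k + m)"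
      "dist (geo (\<lambda>_. False) (base_point k u)) y < 1 / 4 ^ (k + m)"
      using \<gamma>(2)[OF s(2,3)] unfolding \<Gamma>_def by blast
    \<comment> \<open>As g is at most m and A > 1, even the smallest ball contains both points of
      the pair.\<close>
    have "1 / (4::real) ^ (k + m) \<le> A / 4 ^ (k + g)"
      using assms s(4) by (intro frac_le power_increasing) auto
    then have "x \<in> \<Gamma> \<inter> B s" "y \<in> \<Gamma> \<inter> B s" using xy by (auto simp: B_def s(1))
    moreover have "0 < 1 / (4::real) ^ Suc (k + m)" by simp
    then have "x \<noteq> y" using xy(4) by (metis dist_self not_le)
    ultimately have "dist x y / 4 \<le> beta \<Gamma> (B s) * diameter (B s)"
      using beta_ge xy(3) by blast
    then show ?thesis using xy(4) by (simp add: s(1))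
  qed
  have "(\<Sum>s\<in>S. 1 / 4 ^ (fst (fst s) + m + 2)) = (\<Sum>d\<in>D. \<Sum>g\<in>{g0..m}. 1 / (4::real) ^ (fst d + m + 2))"
    unfolding S_def by (subst sum.cartesian_product) (auto intro: sum.cong)
  also have "\<dots> = (\<Sum>k<4 ^ m. \<Sum>u<(4::nat) ^ k. real (M + 1) / 4 ^ (k + m + 2))"
    unfolding D_def by (subst sum.Sigma) (auto simp: m_def case_prod_beta)
  \<comment> \<open>The 4^k base points cancel 4^(-k), and the 4^m generations cancel
    4^(-m).\<close>
  also have "\<dots> = real (M + 1) / 16" by (simp add: power_add)
  finally have total: "(\<Sum>s\<in>S. 1 / (4::real) ^ (fst (fst s) + m + 2)) = real (M + 1) / 16" .
  have "ennreal (real (M + 1) / 16) \<le> ennreal (\<Sum>s\<in>S. beta \<Gamma> (B s) * diameter (B s))"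
    unfolding total[symmetric] by (intro ennreal_leI sum_mono term_ge)
  also have "\<dots> = (\<Sum>s\<in>S. ennreal (beta \<Gamma> (B s) * diameter (B s)))"
    by (intro sum_ennreal[symmetric] order_trans[OF _ term_ge]) auto
  also have "\<dots> = (\<Sum>U\<in>B ` S. ennreal (beta \<Gamma> U * diameter U))"
    by (simp add: sum.reindex[OF inj])
  \<comment> \<open>An infinite sum in \<open>ennreal\<close> is the supremum of its finite
    subsums.\<close>
  also have "\<dots> \<le> (\<Sum>\<^sub>\<infinity>U\<in>vertex_balls A. ennreal (beta \<Gamma> U * diameter U))"
    using \<open>finite S\<close> vertex by (subst nonneg_infsum_complete) (auto intro!: SUP_upper)
  also have "\<dots> \<le> ennreal C * hausdorff1 \<Gamma>"
    unfolding \<Gamma>_def by (intro C(2) rectifiable_curve_lipschitz_image[OF \<gamma>(1)]) simp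
  also have "\<dots> \<le> ennreal C * ennreal 2"
    unfolding \<Gamma>_def by (intro mult_left_mono hausdorff1_lipschitz_image[OF \<gamma>(1)]) auto
  also have "\<dots> = ennreal (2 * C)" using C(1) by (simp add: ennreal_mult' mult.commute)
  finally have "real (M + 1) / 16 \<le> 2 * C" using C(1) by (simp add: ennreal_le_iff)
  then show False using M by simp
qed

end
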